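(* Let $G$ be a (not necessarily finite) group with Cayley table $L$ (rows and columns indexed by $G$, cell $(g,h)$ containing $gh$). Let $X,Y\subseteq G$ be finite, and let $R$ be the submatrix of $L$ with rows indexed by $X$ and columns indexed by $Y$. Suppose $R$ contains exactly $n$ distinct symbols. Then $R$ can be embedded in a Latin square of order $n$, i.e., there is a Latin square of order $n$ on the $n$ symbols of $R$ containing $R$ as a $|X|\times|Y|$ subarray (after suitably ordering rows and columns).
   Context: A Latin square of order $n$ is an $n\times n$ array on $n$ symbols in which each row and each column contains each symbol exactly once. *)

theory Defs
  imports "HOL-Algebra.Group"
begin

definition cayley_table :: "('a, 'b) monoid_scheme \<Rightarrow> 'a \<Rightarrow> 'a \<Rightarrow> 'a" where
  "cayley_table G g h = g \<otimes>\<^bsub>G\<^esub> h"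

text \<open>
  A submatrix is given by its row index set \<open>X\<close>, its column index set \<open>Y\<close> and an entry
  function, which is only looked at on \<open>X \<times> Y\<close>.
\<close>

definition array_symbols :: "'r set \<Rightarrow> 'c set \<Rightarrow> ('r \<Rightarrow> 'c \<Rightarrow> 's) \<Rightarrow> 's set" where
  "array_symbols X Y A = {A x y | x y. x \<in> X \<and> y \<in> Y}"

text \<open>
  A Latin square of order \<open>n\<close> on the symbol set \<open>S\<close>; rows and columns are numbered
  \<open>0, \<dots>, n - 1\<close>, and values of \<open>L\<close> at other indices are irrelevant.
\<close>

definition latin_square :: "nat \<Rightarrow> 's set \<Rightarrow> (nat \<Rightarrow> nat \<Rightarrow> 's) \<Rightarrow> bool" where
  "latin_square n S L \<longleftrightarrow>
     finite S \<and> card S = n \<and>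
     (\<forall>i<n. \<forall>j<n. L i j \<in> S) \<and>
     (\<forall>i<n. \<forall>s\<in>S. \<exists>!j. j < n \<and> L i j = s) \<and>
     (\<forall>j<n. \<forall>s\<in>S. \<exists>!i. i < n \<and> L i j = s)"

text \<open>
  The \<open>n \<times> n\<close> array \<open>L\<close> contains the array \<open>A\<close>, indexed by \<open>X\<close> and \<open>Y\<close>, as a subarray:
  distinct rows (columns) of \<open>A\<close> are placed in distinct rows (columns) of \<open>L\<close>, in any order,
  and the entries agree.
\<close>

definition contains_subarray ::
  "nat \<Rightarrow> (nat \<Rightarrow> nat \<Rightarrow> 's) \<Rightarrow> 'r set \<Rightarrow> 'c set \<Rightarrow> ('r \<Rightarrow> 'c \<Rightarrow> 's) \<Rightarrow> bool" where
  "contains_subarray n L X Y A \<longleftrightarrow>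
     (\<exists>r c. inj_on r X \<and> r ` X \<subseteq> {..<n} \<and> inj_on c Y \<and> c ` Y \<subseteq> {..<n} \<and>
        (\<forall>x\<in>X. \<forall>y\<in>Y. L (r x) (c y) = A x y))"

end

theory Submission
  imports Defs "HOL-Combinatorics.Transposition"
begin

text \<open>
  By Ryser's theorem an \<open>r \<times> s\<close> Latin rectangle on \<open>n\<close> symbols embeds in a Latin square of order
  \<open>n\<close> as soon as every symbol occurs at least \<open>r + s - n\<close> times; this is Koenig's edge colouring
  theorem for bipartite graphs, applied once to add columns and once to add rows. For a
  submatrix of a Cayley table the condition on the number of occurrences is Kemperman's inequality
  \<open>|X| + |Y| \<le> |XY| + |{(x, y) \<in> X \<times> Y. xy = k}|\<close> for \<open>k \<in> XY\<close>. With \<open>A = X\<close> and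
  \<open>C = kY\<^sup>-\<^sup>1\<close> it reads \<open>|A \<union> C| \<le> |AC\<^sup>-\<^sup>1|\<close> whenever some \<open>g\<close> lies in \<open>A \<inter> C\<close>. If \<open>gt \<in> A\<close> and
  \<open>gt\<^sup>-\<^sup>1 \<in> C\<close>, the pairs \<open>(A \<union> At, C \<inter> Ct)\<close> and \<open>(A \<inter> At, C \<union> Ct)\<close> still consist of
  intersecting sets, have no new quotients, and one of them has a union at least as large as
  \<open>A \<union> C\<close>. So one may assume that no such move increases \<open>(|A \<union> C|, |A|)\<close> lexicographically.
  Then \<open>At = A\<close> for all these \<open>t\<close>, hence \<open>z \<mapsto> z\<^sup>-\<^sup>1g\<close> injects \<open>Ag\<^sup>-\<^sup>1 \<inter> gC\<^sup>-\<^sup>1\<close> into \<open>A \<inter> C\<close>,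
  and \<open>Ag\<^sup>-\<^sup>1 \<union> gC\<^sup>-\<^sup>1\<close>, a subset of \<open>AC\<^sup>-\<^sup>1\<close>, has at least \<open>|A \<union> C|\<close> elements.
\<close>

section \<open>Edge colourings of bipartite graphs\<close>

definition edge_coloring :: "('a \<times> 'b) set \<Rightarrow> nat \<Rightarrow> ('a \<Rightarrow> 'b \<Rightarrow> nat) \<Rightarrow> bool" where
  "edge_coloring E d c \<longleftrightarrow>
     (\<forall>x y. (x, y) \<in> E \<longrightarrow> c x y < d) \<and>
     (\<forall>x y y'. (x, y) \<in> E \<longrightarrow> (x, y') \<in> E \<longrightarrow> c x y = c x y' \<longrightarrow> y = y') \<and>
     (\<forall>x x' y. (x, y) \<in> E \<longrightarrow> (x', y) \<in> E \<longrightarrow> c x y = c x' y \<longrightarrow> x = x')"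

text \<open>The vertices of the path that starts at \<open>v\<close> and alternates between colours
  \<alpha> and \<beta>, one predicate for each side of the bipartition.\<close>

inductive kempe_left :: "('a \<times> 'b) set \<Rightarrow> ('a \<Rightarrow> 'b \<Rightarrow> nat) \<Rightarrow> nat \<Rightarrow> nat \<Rightarrow> 'b \<Rightarrow> 'a \<Rightarrow> bool"
  and kempe_right :: "('a \<times> 'b) set \<Rightarrow> ('a \<Rightarrow> 'b \<Rightarrow> nat) \<Rightarrow> nat \<Rightarrow> nat \<Rightarrow> 'b \<Rightarrow> 'b \<Rightarrow> bool"
  for E c \<alpha> \<beta> v where
  start: "kempe_right E c \<alpha> \<beta> v v"
| left: "kempe_right E c \<alpha> \<beta> v y \<Longrightarrow> (x, y) \<in> E \<Longrightarrow> c x y = \<alpha> \<Longrightarrow> kempe_left E c \<alpha> \<beta> v x"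
| right: "kempe_left E c \<alpha> \<beta> v x \<Longrightarrow> (x, y) \<in> E \<Longrightarrow> c x y = \<beta> \<Longrightarrow> kempe_right E c \<alpha> \<beta> v y"

text \<open>The chain cannot be left along an edge coloured \<alpha> or \<beta>: a vertex entered by
  such an edge has no other edge of that colour, and \<open>v\<close>, which is not entered, has no
  edge of colour \<beta>.\<close>

lemma kempe_left_iff_right:
  assumes c: "edge_coloring E d c"
    and v: "\<And>x. (x, v) \<in> E \<Longrightarrow> c x v \<noteq> \<beta>"
    and e: "(x, y) \<in> E" "c x y = \<alpha> \<or> c x y = \<beta>"
  shows "kempe_left E c \<alpha> \<beta> v x \<longleftrightarrow> kempe_right E c \<alpha> \<beta> v y"
proof (cases "c x y = \<alpha>")
  case True
  have "kempe_right E c \<alpha> \<beta> v y" if "kempe_left E c \<alpha> \<beta> v x"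
    using that
  proof cases
    case (left y')
    then have "y' = y" using c e True unfolding edge_coloring_def by metis
    with left show ?thesis by simp
  qed
  then show ?thesis using e True by (blast intro: kempe_left_kempe_right.left)
next
  case False
  then have b: "c x y = \<beta>" using e by simp
  have "kempe_left E c \<alpha> \<beta> v x" if "kempe_right E c \<alpha> \<beta> v y"
    using that
  proof cases
    case start
    then show ?thesis using v e b by blast
  next
    case (right x')
    then have "x' = x" using c e b unfolding edge_coloring_def by metis
    with right show ?thesis by simp
  qed
  then show ?thesis using e b by (blast intro: kempe_left_kempe_right.right)
qed

lemma free_color:
  fixes f :: "'b \<Rightarrow> nat"
  assumes "finite N" "card N < d"
  obtains \<alpha> where "\<alpha> < d" "\<And>y. y \<in> N \<Longrightarrow> f y \<noteq> \<alpha>"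
proof -
  have "card (f ` N) < card {..<d}"
    using assms card_image_le[of N f] by simp
  then have "\<not> {..<d} \<subseteq> f ` N"
    using assms(1) card_mono[of "f ` N" "{..<d}"] by auto
  then show ?thesis using that by blast
qed

text \<open>
  Swapping \<open>\<alpha>\<close> and \<open>\<beta>\<close> along the Kempe chain of \<open>v\<close> frees \<open>\<alpha>\<close> at \<open>v\<close>. The chain enters left
  vertices only through edges of colour \<open>\<alpha>\<close>, so it avoids \<open>u\<close>, where \<open>\<alpha>\<close> remains free.
\<close>

lemma edge_coloring_insert:
  assumes c: "edge_coloring E d c" and uv: "(u, v) \<notin> E"
    and \<alpha>: "\<alpha> < d" "\<And>y. (u, y) \<in> E \<Longrightarrow> c u y \<noteq> \<alpha>"
    and \<beta>: "\<beta> < d" "\<And>x. (x, v) \<in> E \<Longrightarrow> c x v \<noteq> \<beta>"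
  shows "\<exists>c'. edge_coloring (insert (u, v) E) d c'"
proof -
  let ?L = "kempe_left E c \<alpha> \<beta> v" and ?R = "kempe_right E c \<alpha> \<beta> v"
  let ?t = "transpose \<alpha> \<beta>"
  define c1 where "c1 x y = (if ?R y then ?t (c x y) else c x y)" for x y
  \<comment> \<open>The recolouring can be read off from either endpoint of an edge. At each single
    vertex it is thus one injective renaming, so properness survives on both sides.\<close>
  have c1': "c1 x y = (if ?L x then ?t (c x y) else c x y)" if "(x, y) \<in> E" for x y
  proof (cases "c x y = \<alpha> \<or> c x y = \<beta>")
    case True
    then show ?thesis
      using kempe_left_iff_right[OF c \<beta>(2) that] by (simp add: c1_def)
  next
    case False
    then show ?thesis by (auto simp: c1_def transpose_def)
  qed
  have u: "\<not> ?L u"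
    using \<alpha>(2) by (auto elim: kempe_left.cases)
  have tinj: "?t a = ?t b \<longleftrightarrow> a = b" for a b
    by (metis transpose_involutory)
  have c1_lt: "c1 x y < d" if "(x, y) \<in> E" for x y
    using that c \<alpha>(1) \<beta>(1) by (auto simp: c1_def transpose_def edge_coloring_def)
  have c1_row: "y = y'" if "(x, y) \<in> E" "(x, y') \<in> E" "c1 x y = c1 x y'" for x y y'
    using that c tinj unfolding edge_coloring_def by (metis c1')
  have c1_col: "x = x'" if "(x, y) \<in> E" "(x', y) \<in> E" "c1 x y = c1 x' y" for x x' y
    using that c tinj unfolding edge_coloring_def c1_def by metis
  have c1_u: "c1 u y \<noteq> \<alpha>" if "(u, y) \<in> E" for y
    using that u \<alpha>(2) by (simp add: c1')
  have c1_v: "c1 x v \<noteq> \<alpha>" if "(x, v) \<in> E" for x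
    using \<beta>(2)[OF that] kempe_left_kempe_right.start[of E c \<alpha> \<beta> v]
    by (auto simp: c1_def transpose_def)
  define c' where "c' x y = (if x = u \<and> y = v then \<alpha> else c1 x y)" for x y
  have "edge_coloring (insert (u, v) E) d c'"
    unfolding edge_coloring_def
  proof (intro conjI allI impI)
    fix x y assume "(x, y) \<in> insert (u, v) E"
    then show "c' x y < d" using c1_lt \<alpha>(1) by (auto simp: c'_def)
  next
    fix x y y' assume "(x, y) \<in> insert (u, v) E" "(x, y') \<in> insert (u, v) E" "c' x y = c' x y'"
    then show "y = y'"
      using c1_row c1_u by (auto simp: c'_def split: if_splits)
  next
    fix x x' y assume "(x, y) \<in> insert (u, v) E" "(x', y) \<in> insert (u, v) E" "c' x y = c' x' y"
    then show "x = x'"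
      using c1_col c1_v by (auto simp: c'_def split: if_splits)
  qed
  then show ?thesis by blast
qed

text \<open>Induction on the edges: without the edge \<open>(u, v)\<close> both ends have degree
  below \<open>d\<close>, so each has a free colour and \<open>edge_coloring_insert\<close>
  applies.\<close>

theorem bipartite_edge_coloring:
  assumes "finite E"
    and "\<And>x. card {y. (x, y) \<in> E} \<le> d" and "\<And>y. card {x. (x, y) \<in> E} \<le> d"
  shows "\<exists>c. edge_coloring E d c"
  using assms
proof (induction E rule: finite_induct)
  case empty
  then show ?case by (simp add: edge_coloring_def)
next
  case (insert e E)
  obtain u v where e: "e = (u, v)" by force
  have fin: "finite {y. (x, y) \<in> F}" "finite {x. (x, y) \<in> F}"
    if "finite F" for F :: "('a \<times> 'b) set" and x y
    using finite_subset[of "{y. (x, y) \<in> F}" "snd ` F"] finite_subset[of "{x. (x, y) \<in> F}" "fst ` F"] that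
    by force+
  have fin': "finite (insert e E)" using insert.hyps(1) by simp
  have "\<exists>c. edge_coloring E d c"
  proof (rule insert.IH)
    show "card {y. (x, y) \<in> E} \<le> d" for x
      using insert.prems(1)[of x] card_mono[OF fin(1)[OF fin', of x], of "{y. (x, y) \<in> E}"] by force
    show "card {x. (x, y) \<in> E} \<le> d" for y
      using insert.prems(2)[of y] card_mono[OF fin(2)[OF fin', of y], of "{x. (x, y) \<in> E}"] by force
  qed
  then obtain c where c: "edge_coloring E d c" by blast
  have "{y. (u, y) \<in> E} \<subset> {y. (u, y) \<in> insert e E}" "{x. (x, v) \<in> E} \<subset> {x. (x, v) \<in> insert e E}"
    using insert.hyps(2) e by auto
  then have "card {y. (u, y) \<in> E} < d" "card {x. (x, v) \<in> E} < d"
    using insert.prems psubset_card_mono[OF fin(1)[OF fin']] psubset_card_mono[OF fin(2)[OF fin']]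
    by (meson less_le_trans)+
  then obtain \<alpha> \<beta> where "\<alpha> < d" "\<And>y. (u, y) \<in> E \<Longrightarrow> c u y \<noteq> \<alpha>" "\<beta> < d" "\<And>x. (x, v) \<in> E \<Longrightarrow> c x v \<noteq> \<beta>"
    using free_color[OF fin(1)[OF insert.hyps(1), of u], of d "c u"]
      free_color[OF fin(2)[OF insert.hyps(1), of v], of d "\<lambda>x. c x v"]
    by (metis mem_Collect_eq)
  then show ?case
    using edge_coloring_insert[OF c] insert.hyps(2) unfolding e by blast
qed

section \<open>Completing Latin rectangles\<close>

text \<open>Only injectivity is asked for, since a row or column shorter than \<open>card S\<close>
  misses some symbols.\<close>

definition latin_rectangle :: "nat \<Rightarrow> nat \<Rightarrow> 's set \<Rightarrow> (nat \<Rightarrow> nat \<Rightarrow> 's) \<Rightarrow> bool" where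
  "latin_rectangle r s S A \<longleftrightarrow>
     (\<forall>i<r. \<forall>j<s. A i j \<in> S) \<and>
     (\<forall>i<r. inj_on (A i) {..<s}) \<and>
     (\<forall>j<s. inj_on (\<lambda>i. A i j) {..<r})"

lemma latin_rectangle_transpose:
  "latin_rectangle r s S A \<Longrightarrow> latin_rectangle s r S (\<lambda>i j. A j i)"
  by (auto simp: latin_rectangle_def)

lemma latin_rectangle_row:
  assumes "latin_rectangle r n S A" "finite S" "card S = n" "i < r"
  shows "A i ` {..<n} = S"
  using assms
  by (intro card_subset_eq) (auto simp: latin_rectangle_def card_image)

text \<open>Join each row to the symbols it misses. Rows have degree \<open>n - s\<close>, and
  \<open>occ\<close> bounds the degree of each symbol by \<open>n - s\<close>. Each class of an edge
  colouring with \<open>n - s\<close> colours then meets every row once and fills one new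
  column.\<close>

lemma latin_rectangle_add_columns:
  assumes A: "latin_rectangle r s S A" and S: "finite S" "card S = n" and sn: "s \<le> n"
    and occ: "\<And>k. k \<in> S \<Longrightarrow> r + s \<le> n + card {i. i < r \<and> k \<in> A i ` {..<s}}"
  shows "\<exists>B. latin_rectangle r n S B \<and> (\<forall>i<r. \<forall>j<s. B i j = A i j)"
proof -
  define E where "E = {(i, k). i < r \<and> k \<in> S \<and> k \<notin> A i ` {..<s}}"
  have "E \<subseteq> {..<r} \<times> S" by (auto simp: E_def)
  then have finE: "finite E" using S(1) finite_subset by blast
  have row: "{k. (i, k) \<in> E} = S - A i ` {..<s}" if "i < r" for i
    using that by (auto simp: E_def)
  have rowc: "card {k. (i, k) \<in> E} = n - s" if "i < r" for i
    unfolding row[OF that] using A that S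
    by (subst card_Diff_subset) (auto simp: latin_rectangle_def card_image)
  have "\<exists>c. edge_coloring E (n - s) c"
  proof (rule bipartite_edge_coloring[OF finE])
    fix i show "card {k. (i, k) \<in> E} \<le> n - s"
      using rowc by (cases "i < r") (auto simp: E_def)
  next
    fix k show "card {i. (i, k) \<in> E} \<le> n - s"
    proof (cases "k \<in> S")
      case True
      then have "{i. (i, k) \<in> E} = {..<r} - {i. i < r \<and> k \<in> A i ` {..<s}}"
        by (auto simp: E_def)
      then have "card {i. (i, k) \<in> E} = r - card {i. i < r \<and> k \<in> A i ` {..<s}}"
        by (simp add: card_Diff_subset subset_eq)
      then show ?thesis using occ[OF True] by linarith
    qed (auto simp: E_def)
  qed
  then obtain c where c: "edge_coloring E (n - s) c" by blast
  \<comment> \<open>The \<open>n - s\<close> edges at a row have distinct colours, so all colours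
    occur there.\<close>
  have surj: "\<exists>k. (i, k) \<in> E \<and> c i k = m" if "i < r" "m < n - s" for i m
  proof -
    have "c i ` {k. (i, k) \<in> E} = {..<n - s}"
    proof (rule card_subset_eq)
      have "inj_on (c i) {k. (i, k) \<in> E}"
        using c by (auto simp: edge_coloring_def inj_on_def)
      then show "card (c i ` {k. (i, k) \<in> E}) = card {..<n - s}"
        using rowc[OF that(1)] by (simp add: card_image)
    qed (use c in \<open>auto simp: edge_coloring_def\<close>)
    then have "m \<in> c i ` {k. (i, k) \<in> E}" using that(2) by simp
    then show ?thesis by auto
  qed
  define B where "B i j = (if j < s then A i j else SOME k. (i, k) \<in> E \<and> c i k = j - s)" for i j
  have B1: "B i j = A i j" if "j < s" for i j using that by (simp add: B_def)
  have B2: "(i, B i j) \<in> E" "c i (B i j) = j - s" if "i < r" "s \<le> j" "j < n" for i j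
  proof -
    have "j - s < n - s" using that by linarith
    from someI_ex[OF surj[OF that(1) this]] that(2)
    show "(i, B i j) \<in> E" "c i (B i j) = j - s" by (simp_all add: B_def)
  qed
  have "latin_rectangle r n S B"
    unfolding latin_rectangle_def
  proof (intro conjI allI impI)
    fix i j assume ij: "i < r" "j < n"
    show "B i j \<in> S"
      using A B1[of j i] B2(1)[OF ij(1) _ ij(2)] ij
      by (cases "j < s") (auto simp: latin_rectangle_def E_def)
  next
    fix i assume i: "i < r"
    show "inj_on (B i) {..<n}"
    proof (rule linorder_inj_onI)
      fix j j' assume j: "j < j'" "j \<in> {..<n}" "j' \<in> {..<n}"
      show "B i j \<noteq> B i j'"
      proof (cases "j' < s")
        case True
        have "inj_on (A i) {..<s}" using A i by (simp add: latin_rectangle_def)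
        then have "A i j \<noteq> A i j'" using j True by (auto dest: inj_onD)
        then show ?thesis using j True B1[of j i] B1[of j' i] by simp
      next
        case j': False
        show ?thesis
        proof (cases "j < s")
          case True
          then have "B i j \<in> A i ` {..<s}" by (simp add: B1)
          moreover have "B i j' \<notin> A i ` {..<s}" using B2(1)[of i j'] i j j' by (simp add: E_def)
          ultimately show ?thesis by metis
        next
          case False
          then show ?thesis using B2(2)[of i j] B2(2)[of i j'] i j j' by auto
        qed
      qed
    qed auto
  next
    fix j assume j: "j < n"
    show "inj_on (\<lambda>i. B i j) {..<r}"
    proof (cases "j < s")
      case True
      then show ?thesis using A by (simp add: latin_rectangle_def B1)
    next
      case False
      show ?thesis
      proof (rule inj_onI)
        fix i i' assume "i \<in> {..<r}" "i' \<in> {..<r}" "B i j = B i' j"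
        then show "i = i'"
          using B2[of i j] B2[of i' j] False j c unfolding edge_coloring_def
          by (metis lessThan_iff not_less)
      qed
    qed
  qed
  then show ?thesis using B1 by blast
qed

lemma latin_rectangle_complete:
  assumes A: "latin_rectangle r s S A" and S: "finite S" "card S = n" and rs: "r \<le> n" "s \<le> n"
    and occ: "\<And>k. k \<in> S \<Longrightarrow> r + s \<le> n + card {i. i < r \<and> k \<in> A i ` {..<s}}"
  shows "\<exists>L. latin_square n S L \<and> (\<forall>i<r. \<forall>j<s. L i j = A i j)"
proof -
  obtain B where B: "latin_rectangle r n S B" and BA: "\<forall>i<r. \<forall>j<s. B i j = A i j"
    using latin_rectangle_add_columns[OF A S rs(2) occ] by blast
  \<comment> \<open>Rows of \<open>B\<close> are full, so each contains \<open>k\<close>, in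
    different columns for different rows. This is the occurrence condition for the transpose of
    \<open>B\<close>, to which the missing rows are added as columns.\<close>
  have "r \<le> card {j. j < n \<and> k \<in> (\<lambda>i. B i j) ` {..<r}}" if k: "k \<in> S" for k
  proof -
    have "\<forall>i<r. \<exists>j<n. B i j = k"
      using latin_rectangle_row[OF B S] k by (metis imageE lessThan_iff)
    then obtain f where f: "\<And>i. i < r \<Longrightarrow> f i < n \<and> B i (f i) = k" by metis
    have "inj_on f {..<r}"
      using B f unfolding latin_rectangle_def inj_on_def by (metis lessThan_iff)
    moreover have "f ` {..<r} \<subseteq> {j. j < n \<and> k \<in> (\<lambda>i. B i j) ` {..<r}}"
      using f by force
    ultimately show ?thesis using card_inj_on_le[of f "{..<r}"] by simp
  qed
  then obtain L' where L': "latin_rectangle n n S L'" and LB: "\<forall>j<n. \<forall>i<r. L' j i = B i j"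
    using latin_rectangle_add_columns[OF latin_rectangle_transpose[OF B] S rs(1)] by fastforce
  define L where "L i j = L' j i" for i j
  have L: "latin_rectangle n n S L"
    using latin_rectangle_transpose[OF L'] by (simp add: L_def[abs_def])
  have "latin_square n S L"
    unfolding latin_square_def
  proof (intro conjI allI impI ballI S)
    fix i j assume "i < n" "j < n"
    then show "L i j \<in> S" using L by (simp add: latin_rectangle_def)
  next
    fix i k assume i: "i < n" and k: "k \<in> S"
    have "inj_on (L i) {..<n}" using L i by (simp add: latin_rectangle_def)
    then show "\<exists>!j. j < n \<and> L i j = k"
      using latin_rectangle_row[OF L S i] k by (auto simp: inj_on_def)
  next
    fix j k assume j: "j < n" and k: "k \<in> S"
    have "inj_on (L' j) {..<n}" using L' j by (simp add: latin_rectangle_def)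
    then show "\<exists>!i. i < n \<and> L i j = k"
      using latin_rectangle_row[OF L' S j] k by (auto simp: inj_on_def L_def)
  qed
  moreover have "\<forall>i<r. \<forall>j<s. L i j = A i j"
    using LB BA rs by (simp add: L_def)
  ultimately show ?thesis by blast
qed

section \<open>Kemperman's inequality\<close>

text \<open>The two sets on the right have union
  \<open>(A \<union> C) \<union> (A' \<union> C')\<close>, and their intersection contains
  \<open>(A \<union> C) \<inter> (A' \<union> C')\<close>. Hence one of them is at least as large as
  \<open>A \<union> C\<close>.\<close>

lemma card_shift_le:
  assumes fin: "finite A" "finite C" "finite A'" "finite C'"
    and card: "card (A' \<union> C') = card (A \<union> C)"
  shows "2 * card (A \<union> C) \<le> card ((A \<union> A') \<union> (C \<inter> C')) + card ((A \<inter> A') \<union> (C \<union> C'))"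
proof -
  let ?P = "(A \<union> A') \<union> (C \<inter> C')" and ?Q = "(A \<inter> A') \<union> (C \<union> C')"
  have "2 * card (A \<union> C) = card ((A \<union> C) \<union> (A' \<union> C')) + card ((A \<union> C) \<inter> (A' \<union> C'))"
    using card_Un_Int[of "A \<union> C" "A' \<union> C'"] fin card by simp
  also have "\<dots> \<le> card (?P \<union> ?Q) + card (?P \<inter> ?Q)"
    using fin by (intro add_mono card_mono) auto
  also have "\<dots> = card ?P + card ?Q"
    using card_Un_Int[of ?P ?Q] fin by simp
  finally show ?thesis .
qed

context group
begin

lemma inj_on_mult_inv:
  assumes "g \<in> carrier G" "A \<subseteq> carrier G"
  shows "inj_on (\<lambda>a. g \<otimes> inv a) A"
proof (rule inj_onI)
  fix a b assume ab: "a \<in> A" "b \<in> A" "g \<otimes> inv a = g \<otimes> inv b"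
  then have c: "a \<in> carrier G" "b \<in> carrier G" using assms by auto
  then have "inv a = inv b" using ab(3) assms(1) by simp
  then show "a = b" using c inv_inv by metis
qed

text \<open>The terminal case, in which no move changes \<open>A\<close>. As \<open>g\<close> lies
  in both sets, \<open>P\<close> and \<open>Q\<close> below consist of quotients; it remains to
  inject \<open>P \<inter> Q\<close> into \<open>A \<inter> C\<close>.\<close>

lemma card_Un_le_quotients_stable:
  assumes A: "A \<subseteq> carrier G" "finite A" and C: "C \<subseteq> carrier G" "finite C" and S: "finite S"
    and quot: "\<And>a c. a \<in> A \<Longrightarrow> c \<in> C \<Longrightarrow> a \<otimes> inv c \<in> S"
    and g: "g \<in> A" "g \<in> C"
    and stable: "\<And>t. \<lbrakk>t \<in> carrier G; g \<otimes> t \<in> A; g \<otimes> inv t \<in> C\<rbrakk> \<Longrightarrow> (\<lambda>a. a \<otimes> t) ` A = A"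
  shows "card (A \<union> C) \<le> card S"
proof -
  have gc: "g \<in> carrier G" using g A by blast
  define P where "P = (\<lambda>a. a \<otimes> inv g) ` A"
  define Q where "Q = (\<lambda>c. g \<otimes> inv c) ` C"
  have "inj_on (\<lambda>a. a \<otimes> inv g) A"
    using A gc by (intro inj_on_subset[OF inj_on_multc]) auto
  then have cP: "card P = card A" by (simp add: P_def card_image)
  have "inj_on (\<lambda>c. g \<otimes> inv c) C"
    using C gc by (intro inj_on_mult_inv)
  then have cQ: "card Q = card C" by (simp add: Q_def card_image)
  have finPQ: "finite P" "finite Q" using A C by (auto simp: P_def Q_def)
  have "inj_on (\<lambda>z. inv z \<otimes> g) (carrier G)"
    using gc by (auto simp: inj_on_def) (metis inv_inv)
  moreover have "P \<inter> Q \<subseteq> carrier G" using A gc by (auto simp: P_def)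
  ultimately have "inj_on (\<lambda>z. inv z \<otimes> g) (P \<inter> Q)"
    by (rule inj_on_subset)
  moreover have "(\<lambda>z. inv z \<otimes> g) ` (P \<inter> Q) \<subseteq> A \<inter> C"
  proof clarify
    fix z assume z: "z \<in> P" "z \<in> Q"
    obtain a where a: "a \<in> A" "z = a \<otimes> inv g" using z by (auto simp: P_def)
    obtain c where c: "c \<in> C" "z = g \<otimes> inv c" using z by (auto simp: Q_def)
    have ac: "a \<in> carrier G" "c \<in> carrier G" using a c A C by auto
    then have zc: "z \<in> carrier G" using a gc by simp
    have zgc: "inv z \<otimes> g = c"
      using c ac gc by (simp add: inv_mult_group m_assoc)
    \<comment> \<open>This conjugate of \<open>z\<close> satisfies \<open>g \<otimes> t = a\<close>
      and \<open>g \<otimes> inv t = c\<close>, so \<open>stable\<close> applies to it.\<close>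
    define t where "t = inv g \<otimes> z \<otimes> g"
    have t: "t \<in> carrier G" using gc zc by (simp add: t_def)
    have "g \<otimes> t = z \<otimes> g"
      using gc zc by (simp add: t_def m_assoc[symmetric])
    also have "\<dots> = a" using a ac gc by (simp add: m_assoc)
    finally have gt: "g \<otimes> t = a" .
    have "inv t = inv g \<otimes> (inv z \<otimes> g)"
      using gc zc by (simp add: t_def inv_mult_group m_assoc)
    then have gt': "g \<otimes> inv t = inv z \<otimes> g"
      using gc zc by (simp add: m_assoc[symmetric])
    have "(\<lambda>a. a \<otimes> t) ` A = A"
      using stable[OF t] gt gt' zgc a c by simp
    \<comment> \<open>Stability puts \<open>g \<otimes> inv t\<close>, which is
      \<open>inv z \<otimes> g\<close>, into \<open>A\<close> as well as \<open>C\<close>.\<close>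
    then obtain b where b: "b \<in> A" "g = b \<otimes> t" using g(1) by blast
    then have "g \<otimes> inv t = b" using A t by (auto simp: m_assoc)
    then show "inv z \<otimes> g \<in> A \<inter> C" using gt' zgc b c by simp
  qed
  ultimately have "card (P \<inter> Q) \<le> card (A \<inter> C)"
    using A(2) card_inj_on_le by blast
  moreover have "card (P \<union> Q) \<le> card S"
    using quot g S by (intro card_mono) (auto simp: P_def Q_def)
  ultimately show ?thesis
    using card_Un_Int[OF A(2) C(2)] card_Un_Int[OF finPQ] cP cQ by linarith
qed

lemma card_Un_le_quotients:
  assumes S: "finite S"
    and "A \<subseteq> carrier G" "finite A" "C \<subseteq> carrier G" "finite C"
    and "\<And>a c. a \<in> A \<Longrightarrow> c \<in> C \<Longrightarrow> a \<otimes> inv c \<in> S"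
    and "A \<inter> C \<noteq> {}"
  shows "card (A \<union> C) \<le> card S"
proof -
  \<comment> \<open>The lexicographic order on (\<open>card (A \<union> C)\<close>,
    \<open>card A\<close>), reversed. Subtraction truncates, so growth lowers a measure only below
    its cap; \<open>bound\<close> and \<open>bound_Un\<close> establish the caps.\<close>
  define rel where "rel = measures
    [\<lambda>(A, C). 2 * card S - card (A \<union> C), \<lambda>(A :: 'a set, C :: 'a set). card S - card A]"
  have "wf rel" by (simp add: rel_def)
  then show ?thesis
    using assms(2-)
  proof (induction "(A, C)" arbitrary: A C)
    case less
    note A = less.prems(1,2) and C = less.prems(3,4) and quot = less.prems(5)
    obtain g where g: "g \<in> A" "g \<in> C" using less.prems(6) by blast
    have gc: "g \<in> carrier G" using g A by blast
    have bound: "card A' \<le> card S"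
      if "A' \<subseteq> carrier G" "c \<in> C'" "C' \<subseteq> carrier G" "\<And>a c. a \<in> A' \<Longrightarrow> c \<in> C' \<Longrightarrow> a \<otimes> inv c \<in> S"
      for A' C' c
    proof (rule card_inj_on_le[OF _ _ S])
      show "inj_on (\<lambda>a. a \<otimes> inv c) A'"
        using that by (intro inj_on_subset[OF inj_on_multc]) auto
      show "(\<lambda>a. a \<otimes> inv c) ` A' \<subseteq> S" using that by blast
    qed
    have bound_Un: "card (A' \<union> C') \<le> 2 * card S"
      if "A' \<subseteq> carrier G" "C' \<subseteq> carrier G" "h \<in> A'" "h \<in> C'"
        "\<And>a c. a \<in> A' \<Longrightarrow> c \<in> C' \<Longrightarrow> a \<otimes> inv c \<in> S"
      for A' C' h
    proof -
      have "card C' \<le> card S"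
      proof (rule card_inj_on_le[OF _ _ S])
        show "inj_on (\<lambda>c. h \<otimes> inv c) C'"
          using that by (intro inj_on_mult_inv) auto
        show "(\<lambda>c. h \<otimes> inv c) ` C' \<subseteq> S" using that by blast
      qed
      moreover have "card A' \<le> card S"
        by (rule bound[of A' h C']) (use that in auto)
      ultimately show ?thesis using card_Un_le[of A' C'] by linarith
    qed
    show ?case
    proof (cases "\<forall>t. t \<in> carrier G \<longrightarrow> g \<otimes> t \<in> A \<longrightarrow> g \<otimes> inv t \<in> C \<longrightarrow> (\<lambda>a. a \<otimes> t) ` A = A")
      case True
      show ?thesis
        by (rule card_Un_le_quotients_stable[OF A C S quot g]) (use True in auto)
    next
      case False
      then obtain t where t: "t \<in> carrier G" "g \<otimes> t \<in> A" "g \<otimes> inv t \<in> C"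
        and At: "(\<lambda>a. a \<otimes> t) ` A \<noteq> A" by blast
      define A' where "A' = (\<lambda>a. a \<otimes> t) ` A"
      define C' where "C' = (\<lambda>c. c \<otimes> t) ` C"
      have A': "A' \<subseteq> carrier G" "finite A'" using A t by (auto simp: A'_def)
      have C': "C' \<subseteq> carrier G" "finite C'" using C t by (auto simp: C'_def)
      have inj: "inj_on (\<lambda>a. a \<otimes> t) (carrier G)" using t by (intro inj_on_multc)
      have cA': "card A' = card A"
        unfolding A'_def using inj A by (metis card_image inj_on_subset)
      have "A' \<union> C' = (\<lambda>a. a \<otimes> t) ` (A \<union> C)" by (auto simp: A'_def C'_def)
      then have cU: "card (A' \<union> C') = card (A \<union> C)"
        using inj A C by (metis Un_least card_image inj_on_subset)
      \<comment> \<open>Translating both factors on the right by \<open>t\<close> leaves their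
        quotient unchanged.\<close>
      have quot': "a \<otimes> inv c \<in> S" if ac: "a \<in> A'" "c \<in> C'" for a c
      proof -
        obtain b d where b: "b \<in> A" "a = b \<otimes> t" and d: "d \<in> C" "c = d \<otimes> t"
          using ac unfolding A'_def C'_def by blast
        have bd: "b \<in> carrier G" "d \<in> carrier G" using b d A C by auto
        then have "t \<otimes> (inv t \<otimes> inv d) = inv d"
          using t(1) by (simp add: m_assoc[symmetric])
        then have "a \<otimes> inv c = b \<otimes> inv d"
          using b(2) d(2) t(1) bd by (simp add: inv_mult_group m_assoc)
        then show ?thesis using quot b d by simp
      qed
      \<comment> \<open>Since \<open>g\<close> is \<open>(g \<otimes> inv t) \<otimes> t\<close>, it
        stays common to the first new pair; \<open>g \<otimes> t\<close> is common to the
        second.\<close>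
      have gC': "g \<in> C'"
        unfolding C'_def using t gc by (intro image_eqI[OF _ t(3)]) (simp add: m_assoc)
      have gtA': "g \<otimes> t \<in> A'" and gtC': "g \<otimes> t \<in> C'" using g by (auto simp: A'_def C'_def)
      \<comment> \<open>No mixed quotients arise: an element of an intersection can be taken in
        whichever set matches the other factor.\<close>
      have quot1: "a \<otimes> inv c \<in> S" if "a \<in> A \<union> A'" "c \<in> C \<inter> C'" for a c
        using that quot quot' by blast
      have quot2: "a \<otimes> inv c \<in> S" if "a \<in> A \<inter> A'" "c \<in> C \<union> C'" for a c
        using that quot quot' by blast
      have sum: "2 * card (A \<union> C) \<le> card ((A \<union> A') \<union> (C \<inter> C')) + card ((A \<inter> A') \<union> (C \<union> C'))"
        by (rule card_shift_le[OF A(2) C(2) A'(2) C'(2) cU])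
      show ?thesis
      proof (cases "card (A \<union> C) \<le> card ((A \<union> A') \<union> (C \<inter> C'))")
        case True
        \<comment> \<open>\<open>A'\<close> differs from \<open>A\<close> but has the same finite
          size, so the second measure drops even when the first does not.\<close>
        have "A \<subset> A \<union> A'"
          using At cA' A(2) A'(2) unfolding A'_def[symmetric]
          by (metis card_subset_eq psubsetI sup.absorb_iff1 sup_ge1)
        then have gt: "card A < card (A \<union> A')" using A A' by (intro psubset_card_mono) auto
        have "card (A \<union> A') \<le> card S"
          by (rule bound[of _ g "C \<inter> C'"]) (use A A' C g gC' quot1 in auto)
        with gt True have "((A \<union> A', C \<inter> C'), (A, C)) \<in> rel"
          by (auto simp: rel_def)
        then have "card ((A \<union> A') \<union> (C \<inter> C')) \<le> card S"
          by (rule less.hyps) (use A A' C g gC' quot1 in auto)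
        with True show ?thesis by linarith
      next
        case False
        then have gt: "card (A \<union> C) < card ((A \<inter> A') \<union> (C \<union> C'))" using sum by linarith
        have "card ((A \<inter> A') \<union> (C \<union> C')) \<le> 2 * card S"
          by (rule bound_Un[of _ _ "g \<otimes> t"]) (use A C C' t gtA' gtC' quot2 in auto)
        with gt have "((A \<inter> A', C \<union> C'), (A, C)) \<in> rel"
          by (auto simp: rel_def)
        then have "card ((A \<inter> A') \<union> (C \<union> C')) \<le> card S"
          by (rule less.hyps) (use A C C' t gtA' gtC' quot2 in auto)
        with gt show ?thesis by linarith
      qed
    qed
  qed
qed

text \<open>Because \<open>x\<close> determines \<open>y\<close> in
  \<open>x \<otimes> y = k\<close>, the last cardinal is the number of factorizations of
  \<open>k\<close>.\<close>

theorem kemperman: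
  assumes X: "X \<subseteq> carrier G" "finite X" and Y: "Y \<subseteq> carrier G" "finite Y"
    and k: "k \<in> (\<lambda>(x, y). x \<otimes> y) ` (X \<times> Y)"
  shows "card X + card Y \<le> card ((\<lambda>(x, y). x \<otimes> y) ` (X \<times> Y)) + card {x \<in> X. \<exists>y\<in>Y. x \<otimes> y = k}"
proof -
  let ?XY = "(\<lambda>(x, y). x \<otimes> y) ` (X \<times> Y)"
  define C where "C = (\<lambda>y. k \<otimes> inv y) ` Y"
  \<comment> \<open>The quotient of \<open>x\<close> by \<open>k \<otimes> inv y\<close> is
    \<open>(x \<otimes> y) \<otimes> inv k\<close>.\<close>
  define S where "S = (\<lambda>z. z \<otimes> inv k) ` ?XY"
  have kc: "k \<in> carrier G" using k X Y by auto
  have C: "C \<subseteq> carrier G" "finite C" using kc Y by (auto simp: C_def)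
  have finXY: "finite ?XY" using X Y by simp
  have "inj_on (\<lambda>y. k \<otimes> inv y) Y"
    using Y kc by (intro inj_on_mult_inv)
  then have cC: "card C = card Y" by (simp add: C_def card_image)
  have solve: "x = k \<otimes> inv y \<longleftrightarrow> x \<otimes> y = k" if "x \<in> X" "y \<in> Y" for x y
    using that X Y kc by (metis inv_solve_right' subsetD)
  have int: "X \<inter> C = {x \<in> X. \<exists>y\<in>Y. x \<otimes> y = k}"
    using solve by (auto simp: C_def)
  have "card (X \<union> C) \<le> card S"
  proof (rule card_Un_le_quotients[OF _ X C])
    show "finite S" using finXY by (simp add: S_def)
    fix x c assume x: "x \<in> X" "c \<in> C"
    then obtain y where y: "y \<in> Y" "c = k \<otimes> inv y" by (auto simp: C_def)
    have "x \<in> carrier G" "y \<in> carrier G" using x y X Y by auto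
    then have "x \<otimes> inv c = (x \<otimes> y) \<otimes> inv k"
      using kc y by (simp add: inv_mult_group m_assoc)
    then show "x \<otimes> inv c \<in> S" using x y by (auto simp: S_def)
  next
    show "X \<inter> C \<noteq> {}" using k unfolding int by auto
  qed
  also have "\<dots> \<le> card ?XY" unfolding S_def by (rule card_image_le[OF finXY])
  finally show ?thesis
    using card_Un_Int[OF X(2) C(2)] cC int by simp
qed

end

section \<open>Embedding a submatrix of a Cayley table\<close>

lemma finite_enumeration:
  assumes "finite X"
  obtains f where "bij_betw f {..<card X} X"
  using ex_bij_betw_nat_finite[OF assms] by (metis atLeast0LessThan)

theorem theorem4p4:
  fixes G :: "('a, 'b) monoid_scheme" and X Y :: "'a set" and n :: nat
  assumes "group G"
    and "X \<subseteq> carrier G" and "finite X" and "X \<noteq> {}"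
    and "Y \<subseteq> carrier G" and "finite Y" and "Y \<noteq> {}"
    and "card (array_symbols X Y (cayley_table G)) = n"
  shows "\<exists>L. latin_square n (array_symbols X Y (cayley_table G)) L \<and>
             contains_subarray n L X Y (cayley_table G)"
proof -
  interpret group G by fact
  note X = assms(2,3) and Y = assms(5,6)
  let ?S = "array_symbols X Y (cayley_table G)"
  have S_eq: "?S = (\<lambda>(x, y). x \<otimes>\<^bsub>G\<^esub> y) ` (X \<times> Y)"
    by (auto simp: array_symbols_def cayley_table_def)
  have S: "finite ?S" "card ?S = n" using X Y assms(8) by (auto simp: S_eq)
  obtain f where f: "bij_betw f {..<card X} X" using finite_enumeration[OF X(2)] .
  obtain h where h: "bij_betw h {..<card Y} Y" using finite_enumeration[OF Y(2)] .
  have fX: "f i \<in> X" "f i \<in> carrier G" if "i < card X" for i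
    using f that X by (auto simp: bij_betw_def)
  have hY: "h j \<in> Y" "h j \<in> carrier G" if "j < card Y" for j
    using h that Y by (auto simp: bij_betw_def)
  define A where "A i j = f i \<otimes>\<^bsub>G\<^esub> h j" for i j
  have A: "latin_rectangle (card X) (card Y) ?S A"
    using f h fX hY
    by (auto simp: latin_rectangle_def A_def S_eq inj_on_def bij_betw_def)
  \<comment> \<open>Column \<open>y0\<close> of the submatrix shows \<open>card X\<close> distinct
    symbols and row \<open>x0\<close> shows \<open>card Y\<close>, which gives both size
    bounds.\<close>
  obtain x0 y0 where xy0: "x0 \<in> X" "y0 \<in> Y" using assms(4,7) by blast
  have le: "card X \<le> n" "card Y \<le> n"
  proof -
    have "card ((\<lambda>x. x \<otimes>\<^bsub>G\<^esub> y0) ` X) \<le> card ?S" "card ((\<lambda>y. x0 \<otimes>\<^bsub>G\<^esub> y) ` Y) \<le> card ?S"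
      using xy0 S(1) by (auto intro!: card_mono simp: S_eq)
    moreover have "inj_on (\<lambda>x. x \<otimes>\<^bsub>G\<^esub> y0) X" "inj_on (\<lambda>y. x0 \<otimes>\<^bsub>G\<^esub> y) Y"
      using X Y xy0 by (auto simp: inj_on_def subset_iff)
    ultimately show "card X \<le> n" "card Y \<le> n" using S(2) by (simp_all add: card_image)
  qed
  have occ: "card X + card Y \<le> n + card {i. i < card X \<and> k \<in> A i ` {..<card Y}}"
    if k: "k \<in> ?S" for k
  proof -
    \<comment> \<open>The elements counted by \<open>kemperman\<close> are the labels of the rows
      containing \<open>k\<close>, which are the rows counted in the completion criterion.\<close>
    have "{x \<in> X. \<exists>y\<in>Y. x \<otimes>\<^bsub>G\<^esub> y = k} = f ` {i. i < card X \<and> k \<in> A i ` {..<card Y}}"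
      using f h unfolding bij_betw_def A_def by (auto simp: image_iff) (metis imageE lessThan_iff)+
    then have "card {x \<in> X. \<exists>y\<in>Y. x \<otimes>\<^bsub>G\<^esub> y = k} \<le> card {i. i < card X \<and> k \<in> A i ` {..<card Y}}"
      by (simp add: card_image_le)
    then show ?thesis using kemperman[OF X Y] k S(2) unfolding S_eq by fastforce
  qed
  obtain L where L: "latin_square n ?S L" and LA: "\<forall>i<card X. \<forall>j<card Y. L i j = A i j"
    using latin_rectangle_complete[OF A S le occ] by blast
  let ?r = "the_inv_into {..<card X} f" and ?c = "the_inv_into {..<card Y} h"
  have r: "bij_betw ?r X {..<card X}" and c: "bij_betw ?c Y {..<card Y}"
    using f h by (simp_all add: bij_betw_the_inv_into)
  have "L (?r x) (?c y) = cayley_table G x y" if "x \<in> X" "y \<in> Y" for x y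
  proof -
    have "?r x < card X" "?c y < card Y" using r c that by (auto simp: bij_betw_def)
    moreover have "f (?r x) = x" "h (?c y) = y"
      using f h that by (auto simp: bij_betw_def f_the_inv_into_f)
    ultimately show ?thesis using LA by (simp add: A_def cayley_table_def)
  qed
  then have "contains_subarray n L X Y (cayley_table G)"
    unfolding contains_subarray_def using r c le
    by (intro exI[of _ ?r] exI[of _ ?c]) (auto simp: bij_betw_def)
  with L show ?thesis by blast
qed

end
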